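(* Let $N\ge 0$ be an integer and let $\Lambda_N$ be the Markov kernel from $\{0,\dots,N\}$ to $\{0,\dots,N+1\}$ given by $\Lambda_N(x,y)=\frac12$ if $y=x$ or $y=x+1$, and $\Lambda_N(x,y)=0$ otherwise. Then for every $n\in\{0,\dots,N+1\}$, $$\Lambda_N[K_{N+1,n}]=K_{N,n},$$ with the convention $K_{N,N+1}=0$ on $\{0,\dots,N\}$. In particular, $$L_N\Lambda_N=\Lambda_N L_{N+1}.$$
   Context: For an integer $N\ge 0$, the Ehrenfest generator $L_N$ is the $\{0,\dots,N\}\times\{0,\dots,N\}$ matrix whose off-diagonal entries are $L_N(x,x+1)=\frac{N-x}{2}$, $L_N(x,x-1)=\frac{x}{2}$, and $L_N(x,x')=0$ for $|x-x'|\ge 2$, and whose diagonal entries are such that all row sums vanish. The Krawtchouk polynomials $K_{N,n}$, $n\in\{0,\dots,N\}$, are the functions on $\{0,\dots,N\}$ defined by the generating function $$\sum_{n=0}^N K_{N,n}(x)\frac{z^n}{n!}=\Big(1+\frac z2\Big)^x\Big(1-\frac z2\Big)^{N-x},\qquad x\in\{0,\dots,N\},\ z\in\mathbb{C}.$$ A kernel acts on functions by $\Lambda[f](x)=\sum_y\Lambda(x,y)f(y)$. *)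

theory Defs
  imports Complex_Main
    "HOL-Computational_Algebra.Polynomial"
    "Jordan_Normal_Form.Matrix"
begin

text \<open>
  Functions on \<open>{0,\<dots>,N}\<close> are real vectors of dimension \<open>N + 1\<close>, and kernels from
  \<open>{0,\<dots>,N}\<close> to \<open>{0,\<dots>,M}\<close> are \<open>(N + 1) \<times> (M + 1)\<close> matrices, so that the action of a kernel
  on a function is the matrix-vector product.
\<close>

definition ehrenfest_rate :: "nat \<Rightarrow> nat \<Rightarrow> nat \<Rightarrow> real" where
  "ehrenfest_rate N x y =
     (if y = x + 1 then (real N - real x) / 2
      else if x = y + 1 then real x / 2
      else 0)"

definition ehrenfest_generator :: "nat \<Rightarrow> real mat" where
  "ehrenfest_generator N = mat (N + 1) (N + 1) (\<lambda>(x, y).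
     if x = y then - (\<Sum>y'\<in>{0..N} - {x}. ehrenfest_rate N x y') else ehrenfest_rate N x y)"

definition link_kernel :: "nat \<Rightarrow> real mat" where
  "link_kernel N = mat (N + 1) (N + 2) (\<lambda>(x, y). if y = x \<or> y = x + 1 then 1 / 2 else 0)"

definition krawtchouk_gf :: "nat \<Rightarrow> nat \<Rightarrow> (nat \<Rightarrow> real) \<Rightarrow> bool" where
  "krawtchouk_gf N x k \<longleftrightarrow>
     (\<forall>z::complex. (\<Sum>n=0..N. complex_of_real (k n) * (z ^ n / fact n)) =
        (1 + z / 2) ^ x * (1 - z / 2) ^ (N - x))"

text \<open>
  The generating function determines the values for \<open>n \<le> N\<close> (see \<open>krawtchouk_gf_ex1\<close>);
  for \<open>n > N\<close> the value is \<open>0\<close> by convention.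
\<close>

definition krawtchouk_value :: "nat \<Rightarrow> nat \<Rightarrow> nat \<Rightarrow> real" where
  "krawtchouk_value N x = (THE k. krawtchouk_gf N x k \<and> (\<forall>n>N. k n = 0))"

definition krawtchouk :: "nat \<Rightarrow> nat \<Rightarrow> real vec" where
  "krawtchouk N n = vec (N + 1) (\<lambda>x. krawtchouk_value N x n)"

lemma krawtchouk_gf_unique:
  assumes "krawtchouk_gf N x k" "krawtchouk_gf N x l" "n \<le> N"
  shows "k n = l n"
proof -
  define c where "c n = complex_of_real (k n - l n) / fact n" for n
  have "(\<Sum>n\<le>N. c n * z ^ n) = 0" for z
  proof -
    have "(\<Sum>n\<le>N. c n * z ^ n) =
        (\<Sum>n=0..N. complex_of_real (k n) * (z ^ n / fact n)) -
        (\<Sum>n=0..N. complex_of_real (l n) * (z ^ n / fact n))"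
      unfolding sum_subtractf [symmetric] atLeast0AtMost
      by (intro sum.cong refl) (simp add: c_def field_simps)
    then show ?thesis
      using assms by (simp add: krawtchouk_gf_def)
  qed
  then have "\<forall>i\<le>N. c i = 0"
    using polyfun_eq_0 [of c N] by blast
  then show ?thesis
    using \<open>n \<le> N\<close> by (simp add: c_def)
qed

lemma map_poly_of_real_mult:
  "map_poly complex_of_real (p * q) = map_poly complex_of_real p * map_poly complex_of_real q"
  by (intro poly_eqI) (simp add: coeff_map_poly coeff_mult)

lemma map_poly_of_real_power:
  "map_poly complex_of_real (p ^ n) = map_poly complex_of_real p ^ n"
  by (induction n) (simp_all add: map_poly_of_real_mult)

lemma krawtchouk_gf_coeff:
  assumes "x \<le> N"
  defines "p \<equiv> [:1, 1 / 2:] ^ x * [:1, - (1 / 2):] ^ (N - x)"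
  shows "krawtchouk_gf N x (\<lambda>n. fact n * coeff p n)"
    and "\<forall>n>N. fact n * coeff p n = (0::real)"
proof -
  have deg: "degree p \<le> N"
  proof -
    have "degree p \<le> degree ([:1, 1 / 2:] ^ x :: real poly) +
        degree ([:1, - (1 / 2):] ^ (N - x) :: real poly)"
      unfolding p_def by (rule degree_mult_le)
    also have "\<dots> \<le> x + (N - x)"
      by (intro add_mono order.trans [OF degree_power_le]) simp_all
    finally show ?thesis using assms(1) by simp
  qed
  then show "\<forall>n>N. fact n * coeff p n = (0::real)"
    by (auto intro: coeff_eq_0)
  show "krawtchouk_gf N x (\<lambda>n. fact n * coeff p n)"
    unfolding krawtchouk_gf_def
  proof
    fix z :: complex
    define P where "P = map_poly complex_of_real p"
    have P: "P = [:1, 1 / 2:] ^ x * [:1, - (1 / 2):] ^ (N - x)"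
      by (simp add: P_def p_def map_poly_of_real_mult map_poly_of_real_power map_poly_pCons)
    have "(\<Sum>n=0..N. complex_of_real (fact n * coeff p n) * (z ^ n / fact n)) =
        (\<Sum>n\<le>N. coeff P n * z ^ n)"
      unfolding atLeast0AtMost
      by (intro sum.cong refl) (simp add: P_def coeff_map_poly field_simps)
    also have "\<dots> = poly P z"
    proof -
      have "degree P \<le> N"
        using deg by (simp add: P_def degree_map_poly)
      then show ?thesis
        unfolding poly_altdef
        by (intro sum.mono_neutral_right) (auto simp: coeff_eq_0)
    qed
    also have "\<dots> = (1 + z / 2) ^ x * (1 - z / 2) ^ (N - x)"
      by (simp add: P poly_mult poly_power)
    finally show "(\<Sum>n=0..N. complex_of_real (fact n * coeff p n) * (z ^ n / fact n)) =
        (1 + z / 2) ^ x * (1 - z / 2) ^ (N - x)" .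
  qed
qed

lemma krawtchouk_gf_ex1:
  assumes "x \<le> N"
  shows "\<exists>!k. krawtchouk_gf N x k \<and> (\<forall>n>N. k n = 0)"
proof (rule ex_ex1I)
  show "\<exists>k. krawtchouk_gf N x k \<and> (\<forall>n>N. k n = 0)"
    using krawtchouk_gf_coeff [OF assms] by blast
next
  fix k l
  assume "krawtchouk_gf N x k \<and> (\<forall>n>N. k n = 0)" "krawtchouk_gf N x l \<and> (\<forall>n>N. l n = 0)"
  then show "k = l"
    using krawtchouk_gf_unique by (metis ext linorder_le_less_linear)
qed

lemma krawtchouk_value_gf:
  assumes "x \<le> N"
  shows "krawtchouk_gf N x (krawtchouk_value N x)" and "n > N \<Longrightarrow> krawtchouk_value N x n = 0"
  using theI' [OF krawtchouk_gf_ex1 [OF assms]] by (auto simp: krawtchouk_value_def)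

lemma krawtchouk_beyond: "n > N \<Longrightarrow> krawtchouk N n = 0\<^sub>v (N + 1)"
  by (intro eq_vecI) (simp_all add: krawtchouk_def krawtchouk_value_gf(2))

lemma link_kernel_markov:
  assumes "x \<le> N"
  shows "\<forall>y\<le>N + 1. 0 \<le> link_kernel N $$ (x, y)"
    and "(\<Sum>y=0..N + 1. link_kernel N $$ (x, y)) = 1"
proof -
  show "\<forall>y\<le>N + 1. 0 \<le> link_kernel N $$ (x, y)"
    using assms by (simp add: link_kernel_def)
  have "(\<Sum>y=0..N + 1. link_kernel N $$ (x, y)) =
      (\<Sum>y=0..N + 1. if y \<in> {x, x + 1} then 1 / 2 else 0)"
    using assms by (intro sum.cong refl) (simp add: link_kernel_def)
  also have "\<dots> = (\<Sum>y\<in>{0..N + 1} \<inter> {x, x + 1}. 1 / 2)"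
    by (simp only: sum.inter_restrict finite_atLeastAtMost)
  also have "{0..N + 1} \<inter> {x, x + 1} = {x, x + 1}"
    using assms by auto
  finally show "(\<Sum>y=0..N + 1. link_kernel N $$ (x, y)) = 1"
    by simp
qed

lemma ehrenfest_generator_row_sum:
  assumes "x \<le> N"
  shows "(\<Sum>y=0..N. ehrenfest_generator N $$ (x, y)) = 0"
proof -
  have "(\<Sum>y=0..N. ehrenfest_generator N $$ (x, y)) =
      ehrenfest_generator N $$ (x, x) + (\<Sum>y\<in>{0..N} - {x}. ehrenfest_generator N $$ (x, y))"
    using assms by (intro sum.remove) auto
  also have "(\<Sum>y\<in>{0..N} - {x}. ehrenfest_generator N $$ (x, y)) =
      (\<Sum>y\<in>{0..N} - {x}. ehrenfest_rate N x y)"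
    using assms by (intro sum.cong) (auto simp: ehrenfest_generator_def)
  finally show ?thesis
    using assms by (simp add: ehrenfest_generator_def)
qed

end

theory Submission
  imports Defs
begin

text \<open>
  The two neighbours \<open>x\<close> and \<open>x + 1\<close> of the link contribute the generating function of
  \<open>K\<^bsub>N,n\<^esub>(x)\<close> multiplied by \<open>1 - z/2\<close> and by \<open>1 + z/2\<close>; the average of these two factors is \<open>1\<close>.
  The intertwining relation is checked entry by entry: the diagonal of the generator is
  constantly \<open>-N/2\<close>, and the out-of-range rates vanish by themselves.
\<close>

text \<open>Replaces the definite description by a coefficient of an explicit real polynomial, valid
  for every \<open>n\<close>, since both sides vanish beyond \<open>N\<close>.\<close>

lemma krawtchouk_value_eq_coeff:
  assumes "x \<le> N"
  shows "krawtchouk_value N x n = fact n * coeff ([:1, 1 / 2:] ^ x * [:1, - (1 / 2):] ^ (N - x)) n"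
  unfolding krawtchouk_value_def
  by (subst the1_equality [OF krawtchouk_gf_ex1 [OF assms]])
    (use krawtchouk_gf_coeff [OF assms] in auto)

lemma krawtchouk_value_avg:
  assumes "x \<le> N"
  shows "(krawtchouk_value (N + 1) x n + krawtchouk_value (N + 1) (x + 1) n) / 2 =
    krawtchouk_value N x n"
proof -
  define p :: "real poly" where "p = [:1, 1 / 2:] ^ x * [:1, - (1 / 2):] ^ (N - x)"
  \<comment> \<open>In successor form, \<open>power_Suc\<close> can split off the extra factor 1 -
    z/2.\<close>
  have "N + 1 - x = Suc (N - x)"
    using assms by simp
  then have "krawtchouk_value (N + 1) x n = fact n * coeff ([:1, - (1 / 2):] * p) n"
    using assms by (simp only: krawtchouk_value_eq_coeff p_def power_Suc mult.left_commute)
  moreover have "krawtchouk_value (N + 1) (x + 1) n = fact n * coeff ([:1, 1 / 2:] * p) n"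
    using assms by (simp add: krawtchouk_value_eq_coeff p_def mult.assoc del: mult_pCons_left)
  ultimately have "krawtchouk_value (N + 1) x n + krawtchouk_value (N + 1) (x + 1) n =
      2 * (fact n * coeff p n)"
    by (simp add: coeff_pCons algebra_simps split: nat.split)
  then show ?thesis
    using assms by (simp add: krawtchouk_value_eq_coeff p_def)
qed

text \<open>With \<open>f\<close> arbitrary, this serves both for the values of a Krawtchouk
  polynomial and for a column of the larger generator.\<close>

lemma link_kernel_row_sum:
  assumes "x \<le> N"
  shows "(\<Sum>y=0..<N + 2. link_kernel N $$ (x, y) * f y) = (f x + f (x + 1)) / 2"
proof -
  have "(\<Sum>y=0..<N + 2. link_kernel N $$ (x, y) * f y) =
      (\<Sum>y=0..<N + 2. (if y = x then f y / 2 else 0) + (if y = x + 1 then f y / 2 else 0))"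
    using assms by (intro sum.cong refl) (auto simp: link_kernel_def)
  then show ?thesis
    using assms by (simp add: sum.distrib)
qed

lemma link_kernel_col_sum:
  assumes "y \<le> N + 1"
  shows "(\<Sum>x=0..<N + 1. f x * link_kernel N $$ (x, y)) =
    ((if y \<le> N then f y else 0) + (if y = 0 then 0 else f (y - 1))) / 2"
proof -
  \<comment> \<open>Truncated subtraction gives \<open>y - 1 = 0\<close> at \<open>y = 0\<close>;
    the inner test removes this spurious neighbour.\<close>
  have "(\<Sum>x=0..<N + 1. f x * link_kernel N $$ (x, y)) =
      (\<Sum>x=0..<N + 1. (if x = y then f x / 2 else 0) +
        (if x = y - 1 then if y = 0 then 0 else f x / 2 else 0))"
    using assms by (intro sum.cong refl) (auto simp: link_kernel_def)
  then show ?thesis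
    using assms by (auto simp: sum.distrib)
qed

text \<open>The case \<open>n = N + 1\<close> is included: there the right-hand side is the zero
  vector by \<open>krawtchouk_beyond\<close>.\<close>

lemma link_kernel_krawtchouk:
  "link_kernel N *\<^sub>v krawtchouk (N + 1) n = krawtchouk N n"
proof (rule eq_vecI)
  fix x
  assume "x < dim_vec (krawtchouk N n)"
  then have x: "x \<le> N"
    by (simp add: krawtchouk_def)
  have "(link_kernel N *\<^sub>v krawtchouk (N + 1) n) $ x =
      (\<Sum>y=0..<N + 2. link_kernel N $$ (x, y) * krawtchouk_value (N + 1) y n)"
    using x by (simp add: link_kernel_def krawtchouk_def scalar_prod_def)
  also have "\<dots> = krawtchouk_value N x n"
    using x by (simp only: link_kernel_row_sum krawtchouk_value_avg)
  finally show "(link_kernel N *\<^sub>v krawtchouk (N + 1) n) $ x = krawtchouk N n $ x"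
    using x by (simp add: krawtchouk_def)
qed (simp add: link_kernel_def krawtchouk_def)

lemma ehrenfest_rate_sum:
  assumes "x \<le> N"
  shows "(\<Sum>y\<in>{0..N} - {x}. ehrenfest_rate N x y) = real N / 2"
proof -
  have "(\<Sum>y\<in>{0..N} - {x}. ehrenfest_rate N x y) = (\<Sum>y=0..N. ehrenfest_rate N x y)"
    by (intro sum.mono_neutral_left) (auto simp: ehrenfest_rate_def)
  \<comment> \<open>No boundary cases arise: at \<open>x = 0\<close>, where \<open>x - 1\<close> is
    again 0, the down-rate is 0, and at \<open>x = N\<close> the up-rate is 0.\<close>
  also have "\<dots> = (\<Sum>y=0..N. (if y = x + 1 then (real N - real x) / 2 else 0) +
      (if y = x - 1 then real x / 2 else 0))"
    by (intro sum.cong refl) (auto simp: ehrenfest_rate_def)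
  also have "\<dots> = real N / 2"
    using assms by (auto simp: sum.distrib field_simps)
  finally show ?thesis .
qed

lemma ehrenfest_generator_entry:
  assumes "x \<le> N" "y \<le> N"
  shows "ehrenfest_generator N $$ (x, y) =
    (if x = y then - (real N / 2) else ehrenfest_rate N x y)"
  using assms by (simp add: ehrenfest_generator_def ehrenfest_rate_sum)

lemma ehrenfest_link_intertwining:
  "ehrenfest_generator N * link_kernel N = link_kernel N * ehrenfest_generator (N + 1)"
proof (rule eq_matI)
  let ?L = "ehrenfest_generator N" and ?M = "ehrenfest_generator (N + 1)"
  fix x y
  assume "x < dim_row (link_kernel N * ?M)" "y < dim_col (link_kernel N * ?M)"
  then have xy: "x \<le> N" "y \<le> N + 1"
    by (simp_all add: link_kernel_def ehrenfest_generator_def)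
  have "(?L * link_kernel N) $$ (x, y) = (\<Sum>i=0..<N + 1. ?L $$ (x, i) * link_kernel N $$ (i, y))"
    using xy by (simp add: ehrenfest_generator_def link_kernel_def scalar_prod_def)
  also have "\<dots> = ((if y \<le> N then ?L $$ (x, y) else 0) +
      (if y = 0 then 0 else ?L $$ (x, y - 1))) / 2"
    by (rule link_kernel_col_sum [OF xy(2)])
  \<comment> \<open>For \<open>y = x\<close> and \<open>y = x + 1\<close>, passing to
    \<open>N + 1\<close> lowers the diagonal entry by 1/2 and raises the neighbouring rate by 1/2.
    For \<open>y = x - 1\<close> and \<open>y = x + 2\<close>, a single equal rate survives on each
    side.\<close>
  also have "\<dots> = (?M $$ (x, y) + ?M $$ (x + 1, y)) / 2"
    using xy by (auto simp: ehrenfest_generator_entry ehrenfest_rate_def field_simps)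
  also have "\<dots> = (\<Sum>i=0..<N + 2. link_kernel N $$ (x, i) * ?M $$ (i, y))"
    by (rule link_kernel_row_sum [OF xy(1), symmetric])
  also have "\<dots> = (link_kernel N * ?M) $$ (x, y)"
    using xy by (simp add: ehrenfest_generator_def link_kernel_def scalar_prod_def)
  finally show "(?L * link_kernel N) $$ (x, y) = (link_kernel N * ?M) $$ (x, y)" .
qed (simp_all add: ehrenfest_generator_def link_kernel_def)

theorem lemma3:
  fixes N :: nat
  shows "(\<forall>n\<in>{0..N + 1}. link_kernel N *\<^sub>v krawtchouk (N + 1) n = krawtchouk N n) \<and>
    ehrenfest_generator N * link_kernel N = link_kernel N * ehrenfest_generator (N + 1)"
  using link_kernel_krawtchouk ehrenfest_link_intertwining by blast

end
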